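(* Let $\mathcal{A} = (a_{i_1\cdots i_m})$ be a real $m$th order $n$-dimensional tensor. Then: (i) if $\mathcal{A}$ is semi-positive, then $a_{ii\cdots i} \geq 0$ for all $i \in I_n$; (ii) if $\mathcal{A}$ is strictly semi-positive, then $a_{ii\cdots i} > 0$ for all $i \in I_n$; (iii) if $\mathcal{A}$ is semi-positive, then there exists $k \in I_n$ such that $\sum_{i_2,\dots,i_m=1}^n a_{k i_2\cdots i_m} \geq 0$; (iv) if $\mathcal{A}$ is strictly semi-positive, then there exists $k \in I_n$ such that $\sum_{i_2,\dots,i_m=1}^n a_{k i_2\cdots i_m} > 0$.
   Context: $m,n$ are positive integers and $I_n = \{1,2,\dots,n\}$. A real $m$th order $n$-dimensional tensor is a multi-array $\mathcal{A} = (a_{i_1\cdots i_m})$ of real numbers with $i_j \in I_n$ for $j = 1,\dots,m$; no symmetry is assumed. For $\mathbf{x} \in \mathbb{R}^n$, $\mathcal{A}\mathbf{x}^{m-1} \in \mathbb{R}^n$ is the vector with components $(\mathcal{A}\mathbf{x}^{m-1})_i = \sum_{i_2,\dots,i_m=1}^n a_{i i_2\cdots i_m} x_{i_2}\cdots x_{i_m}$, $i \in I_n$. $\mathbf{x} \geq \mathbf{0}$ means $x_i \geq 0$ for all $i \in I_n$. $\mathcal{A}$ is semi-positive (respectively strictly semi-positive) iff for each $\mathbf{x} \in \mathbb{R}^n$ with $\mathbf{x} \geq \mathbf{0}$ and $\mathbf{x} \neq \mathbf{0}$ there exists $k \in I_n$ such that $x_k > 0$ and $(\mathcal{A}\mathbf{x}^{m-1})_k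 \geq 0$ (respectively $(\mathcal{A}\mathbf{x}^{m-1})_k > 0$). *)

theory Defs
  imports "HOL-Analysis.Analysis"
begin

text \<open>
  An \<open>m\<close>th order \<open>n\<close>-dimensional real tensor is a function on index lists over a finite
  type \<open>'n\<close> with \<open>n\<close> elements: \<open>A [i1, ..., im]\<close> is the entry with indices \<open>i1, ..., im\<close>.
  Only the values on lists of length \<open>m\<close> are entries of the tensor; the values on lists of
  any other length are never consulted below.
\<close>

type_synonym 'n tensor = "'n list \<Rightarrow> real"

text \<open>For \<open>m = 1\<close> the only list of length \<open>m - 1\<close> is \<open>[]\<close> and the product is empty.\<close>

definition tensor_apply :: "nat \<Rightarrow> 'n::finite tensor \<Rightarrow> real ^ 'n \<Rightarrow> real ^ 'n" where
  "tensor_apply m A x =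
     (\<chi> i. \<Sum>js | length js = m - 1. A (i # js) * (\<Prod>j\<leftarrow>js. x $ j))"

definition semi_positive :: "nat \<Rightarrow> 'n::finite tensor \<Rightarrow> bool" where
  "semi_positive m A \<longleftrightarrow>
     (\<forall>x :: real ^ 'n. (\<forall>i. x $ i \<ge> 0) \<and> x \<noteq> 0 \<longrightarrow>
        (\<exists>k. x $ k > 0 \<and> tensor_apply m A x $ k \<ge> 0))"

definition strictly_semi_positive :: "nat \<Rightarrow> 'n::finite tensor \<Rightarrow> bool" where
  "strictly_semi_positive m A \<longleftrightarrow>
     (\<forall>x :: real ^ 'n. (\<forall>i. x $ i \<ge> 0) \<and> x \<noteq> 0 \<longrightarrow>
        (\<exists>k. x $ k > 0 \<and> tensor_apply m A x $ k > 0))"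

text \<open>The index set of the sums is finite, so they do not collapse to 0 by convention.\<close>

lemma finite_index_lists: "finite {js :: 'n::finite list. length js = k}"
  using finite_lists_length_eq[of "UNIV :: 'n set" k] by simp

end

theory Submission
  imports Defs
begin

text \<open>
  Both kinds of semi-positivity give information for every nonzero nonnegative vector, so it
  suffices to test two of them. At the unit vector of index \<open>i\<close> the only positive component is
  the \<open>i\<close>th, so the index \<open>k\<close> supplied by semi-positivity must be \<open>i\<close> itself; moreover all
  monomials vanish there except the one in \<open>x $ i\<close> alone, so what is left of the \<open>i\<close>th
  component is the diagonal entry (\<open>tensor_apply_axis\<close>). At the all-ones vector every monomial
  is \<open>1\<close>, so the components are the sums of the slices (\<open>tensor_apply_one\<close>).
\<close>

lemma prod_list_axis:
  "(\<Prod>j\<leftarrow>js. axis i (1::real) $ j) = (if js = replicate (length js) i then 1 else 0)"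
  by (induction js) (auto simp: axis_def)

lemma tensor_apply_axis:
  fixes A :: "'n::finite tensor"
  shows "tensor_apply m A (axis i 1) $ k = A (k # replicate (m - 1) i)"
proof -
  have "tensor_apply m A (axis i 1) $ k =
      (\<Sum>js | length js = m - 1. if js = replicate (m - 1) i then A (k # js) else 0)"
    by (auto simp: tensor_apply_def prod_list_axis intro!: sum.cong)
  also have "\<dots> = A (k # replicate (m - 1) i)"
    by (simp add: sum.delta finite_index_lists)
  finally show ?thesis .
qed

lemma tensor_apply_one:
  "tensor_apply m A 1 $ k = (\<Sum>js | length js = m - 1. A (k # js))"
  by (simp add: tensor_apply_def map_replicate_const prod_list_replicate)

text \<open>
  Stated for an arbitrary property \<open>P\<close> of the \<open>k\<close>th component, so that the same argument
  serves the weak and the strict notion.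
\<close>

lemma diagonal_entry_from_test:
  fixes A :: "'n::finite tensor"
  assumes "m \<ge> 1"
    and test: "\<And>x :: real ^ 'n. (\<forall>i. x $ i \<ge> 0) \<Longrightarrow> x \<noteq> 0 \<Longrightarrow>
      \<exists>k. x $ k > 0 \<and> P (tensor_apply m A x $ k)"
  shows "P (A (replicate m i))"
proof -
  have "\<forall>j. axis i (1::real) $ j \<ge> 0"
    by (simp add: axis_def)
  then obtain k where k: "axis i (1::real) $ k > 0" "P (tensor_apply m A (axis i 1) $ k)"
    using test[of "axis i 1"] by (auto simp: axis_eq_0_iff)
  then have "k = i"
    by (auto simp: axis_def split: if_splits)
  moreover have "i # replicate (m - 1) i = replicate m i"
    using \<open>m \<ge> 1\<close> by (cases m) auto
  ultimately show ?thesis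
    using k(2) by (simp add: tensor_apply_axis)
qed

lemma slice_sum_from_test:
  fixes A :: "'n::finite tensor"
  assumes "\<And>x :: real ^ 'n. (\<forall>i. x $ i \<ge> 0) \<Longrightarrow> x \<noteq> 0 \<Longrightarrow>
      \<exists>k. x $ k > 0 \<and> P (tensor_apply m A x $ k)"
  shows "\<exists>k. P (\<Sum>js | length js = m - 1. A (k # js))"
  using assms[of 1] by (auto simp: tensor_apply_one vec_eq_iff)

theorem proposition2p1:
  fixes m :: nat and A :: "'n::finite tensor"
  assumes "m \<ge> 1"
  shows "(semi_positive m A \<longrightarrow> (\<forall>i. A (replicate m i) \<ge> 0)) \<and>
    (strictly_semi_positive m A \<longrightarrow> (\<forall>i. A (replicate m i) > 0)) \<and>
    (semi_positive m A \<longrightarrow> (\<exists>k. (\<Sum>js | length js = m - 1. A (k # js)) \<ge> 0)) \<and>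
    (strictly_semi_positive m A \<longrightarrow> (\<exists>k. (\<Sum>js | length js = m - 1. A (k # js)) > 0))"
  unfolding semi_positive_def strictly_semi_positive_def
  using diagonal_entry_from_test[OF assms, of "\<lambda>t. t \<ge> 0" A]
    diagonal_entry_from_test[OF assms, of "\<lambda>t. t > 0" A]
    slice_sum_from_test[of "\<lambda>t. t \<ge> 0" m A]
    slice_sum_from_test[of "\<lambda>t. t > 0" m A]
  by blast

end
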